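(* Let $G$ be an $\mathfrak{M}_C$-group. Then for every group $K$ elementarily equivalent to $G$, the Fitting subgroup $F(K)$ is nilpotent and definable in $K$.
   Context: For an arbitrary group $G$, the Fitting subgroup $F(G)$ is the subgroup generated by all normal nilpotent subgroups of $G$. An $\mathfrak{M}_C$-group is a group satisfying the descending chain condition on centralizers: there is no infinite strictly descending chain $C_G(A_1)>C_G(A_2)>\cdots$ of centralizers of subsets $A_i\subseteq G$. Two groups are elementarily equivalent if they satisfy the same first-order sentences in the language of groups. A subset of $K$ is definable if it is the set of solutions in $K$ of a first-order formula in the language of groups, possibly with parameters from $K$. *)

theory Defs
  imports "HOL-Algebra.Generated_Groups"
begin

section \<open>Centralizers and the descending chain condition\<close>

definition centralizer :: "('a, 'b) monoid_scheme \<Rightarrow> 'a set \<Rightarrow> 'a set" where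
  "centralizer G A = {g \<in> carrier G. \<forall>a\<in>A. g \<otimes>\<^bsub>G\<^esub> a = a \<otimes>\<^bsub>G\<^esub> g}"

definition MC_group :: "('a, 'b) monoid_scheme \<Rightarrow> bool" where
  "MC_group G \<longleftrightarrow> group G \<and>
     \<not> (\<exists>A :: nat \<Rightarrow> 'a set. (\<forall>i. A i \<subseteq> carrier G) \<and>
          (\<forall>i. centralizer G (A (Suc i)) \<subset> centralizer G (A i)))"

section \<open>Nilpotency and the Fitting subgroup\<close>

text \<open>Indexing starts at 0: \<open>lower_central G n\<close> is the usual term \<open>\<gamma>\<^sub>n\<^sub>+\<^sub>1(G)\<close>.\<close>

primrec lower_central :: "('a, 'b) monoid_scheme \<Rightarrow> nat \<Rightarrow> 'a set" where
  "lower_central G 0 = carrier G"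
| "lower_central G (Suc n) =
     generate G {x \<otimes>\<^bsub>G\<^esub> y \<otimes>\<^bsub>G\<^esub> inv\<^bsub>G\<^esub> x \<otimes>\<^bsub>G\<^esub> inv\<^bsub>G\<^esub> y | x y.
       x \<in> lower_central G n \<and> y \<in> carrier G}"

definition nilpotent_group :: "('a, 'b) monoid_scheme \<Rightarrow> bool" where
  "nilpotent_group G \<longleftrightarrow> group G \<and> (\<exists>n. lower_central G n = {\<one>\<^bsub>G\<^esub>})"

definition fitting :: "('a, 'b) monoid_scheme \<Rightarrow> 'a set" where
  "fitting G = generate G (\<Union>{N. N \<lhd> G \<and> nilpotent_group (G\<lparr>carrier := N\<rparr>)})"

section \<open>First-order logic in the language of groups\<close>

datatype gterm = GVar nat | GOne | GMult gterm gterm | GInv gterm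

datatype gformula =
    FEq gterm gterm
  | FNeg gformula
  | FConj gformula gformula
  | FEx nat gformula

primrec term_vars :: "gterm \<Rightarrow> nat set" where
  "term_vars (GVar x) = {x}"
| "term_vars GOne = {}"
| "term_vars (GMult s t) = term_vars s \<union> term_vars t"
| "term_vars (GInv t) = term_vars t"

primrec free_vars :: "gformula \<Rightarrow> nat set" where
  "free_vars (FEq s t) = term_vars s \<union> term_vars t"
| "free_vars (FNeg \<phi>) = free_vars \<phi>"
| "free_vars (FConj \<phi> \<psi>) = free_vars \<phi> \<union> free_vars \<psi>"
| "free_vars (FEx x \<phi>) = free_vars \<phi> - {x}"

primrec term_val :: "('a, 'b) monoid_scheme \<Rightarrow> (nat \<Rightarrow> 'a) \<Rightarrow> gterm \<Rightarrow> 'a" where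
  "term_val G e (GVar x) = e x"
| "term_val G e GOne = \<one>\<^bsub>G\<^esub>"
| "term_val G e (GMult s t) = term_val G e s \<otimes>\<^bsub>G\<^esub> term_val G e t"
| "term_val G e (GInv t) = inv\<^bsub>G\<^esub> (term_val G e t)"

primrec sat :: "('a, 'b) monoid_scheme \<Rightarrow> (nat \<Rightarrow> 'a) \<Rightarrow> gformula \<Rightarrow> bool" where
  "sat G e (FEq s t) \<longleftrightarrow> term_val G e s = term_val G e t"
| "sat G e (FNeg \<phi>) \<longleftrightarrow> \<not> sat G e \<phi>"
| "sat G e (FConj \<phi> \<psi>) \<longleftrightarrow> sat G e \<phi> \<and> sat G e \<psi>"
| "sat G e (FEx x \<phi>) \<longleftrightarrow> (\<exists>a\<in>carrier G. sat G (e(x := a)) \<phi>)"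

definition models :: "('a, 'b) monoid_scheme \<Rightarrow> gformula \<Rightarrow> bool" where
  "models G \<phi> \<longleftrightarrow> (\<forall>e. range e \<subseteq> carrier G \<longrightarrow> sat G e \<phi>)"

definition elementarily_equivalent ::
    "('a, 'b) monoid_scheme \<Rightarrow> ('c, 'd) monoid_scheme \<Rightarrow> bool" where
  "elementarily_equivalent G K \<longleftrightarrow>
     (\<forall>\<phi>. free_vars \<phi> = {} \<longrightarrow> (models G \<phi> \<longleftrightarrow> models K \<phi>))"

text \<open>The parameters are the values that \<open>e\<close> assigns to the free variables of \<open>\<phi>\<close> other
  than \<open>x\<close>.\<close>

definition definable :: "('a, 'b) monoid_scheme \<Rightarrow> 'a set \<Rightarrow> bool" where
  "definable K S \<longleftrightarrow>
     (\<exists>\<phi> x e. range e \<subseteq> carrier K \<and> S = {a \<in> carrier K. sat K (e(x := a)) \<phi>})"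

end

theory Submission
  imports Defs
begin

text \<open>
  Relative to a normal subgroup \<open>N\<close>, let \<open>\<zeta>\<^sub>0 = 1\<close> and
  \<open>\<zeta>\<^sub>s\<^sub>+\<^sub>1 = {g. [g, N] \<subseteq> \<zeta>\<^sub>s}\<close>; then \<open>N\<close> is nilpotent iff \<open>N \<subseteq> \<zeta>\<^sub>s\<close> for some
  \<open>s\<close>. Write \<open>Z\<^sub>j\<close> for these subgroups when \<open>N\<close> is the whole group.

  The Fitting subgroup of an \<open>\<M>\<^sub>C\<close>-group is again an \<open>\<M>\<^sub>C\<close>-group and the directed union of nilpotent
  normal subgroups, so let \<open>G\<close> be of this kind and not nilpotent. Among the normal subgroups
  contained in no \<open>Z\<^sub>j\<close> choose \<open>U\<close> with \<open>C(U)\<close> maximal. Every nilpotent normal \<open>N\<close> has some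
  \<open>V \<subseteq> U\<close> of the same kind with \<open>[V, N] \<subseteq> Z\<^sub>j\<close>, and \<open>C(V) = C(U)\<close>. It suffices to find a normal
  \<open>X\<close> not inside \<open>C(U)\<close> with \<open>[X, G] \<subseteq> C(U)\<close> and \<open>[V, X] \<subseteq> Z\<^sub>j\<close>: the three subgroups lemma then
  shows that the \<open>j\<close>-fold commutator \<open>[V, G, \<dots>, G]\<close>, which still lies in no \<open>Z\<^sub>i\<close>, is
  centralized by \<open>X\<close>, against the maximality of \<open>C(U)\<close>. Let \<open>D\<close> be the centralizer of all
  \<open>Z\<^sub>j\<close>, which by the chain condition is \<open>C(Z\<^sub>j)\<close> for some \<open>j\<close>. If \<open>D \<subseteq> C(U)\<close>, then \<open>G / C(U)\<close> is
  nilpotent and \<open>X\<close> comes from its center. Otherwise \<open>X\<close> is found inside \<open>D\<close> with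
  \<open>[V, X] \<subseteq> Z\<^sub>1\<close>, using a nilpotent normal subgroup \<open>N\<close> with \<open>C(N) = Z\<^sub>1\<close>; two more applications of
  the three subgroups lemma give \<open>[X, G] \<subseteq> C(U)\<close>.

  If \<open>F(G)\<close> is nilpotent of class \<open>n\<close>, it consists of the elements whose normal closure is
  nilpotent of class at most \<open>n\<close>. This is a first-order condition on the element, and
  first-order sentences express that the bound \<open>n\<close> is uniform and that the elements satisfying it
  generate a subgroup of class at most \<open>n\<close>; so all of this passes to \<open>K\<close>.
\<close>

section \<open>Commutators and relative upper central series\<close>

definition comm :: "('a, 'b) monoid_scheme \<Rightarrow> 'a \<Rightarrow> 'a \<Rightarrow> 'a" where
  "comm G x y = x \<otimes>\<^bsub>G\<^esub> y \<otimes>\<^bsub>G\<^esub> inv\<^bsub>G\<^esub> x \<otimes>\<^bsub>G\<^esub> inv\<^bsub>G\<^esub> y"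

text \<open>For normal \<open>M\<close> this is the preimage of the centralizer of the image of
  \<open>W\<close> in the quotient by \<open>M\<close>.\<close>

definition centralizer_mod :: "('a, 'b) monoid_scheme \<Rightarrow> 'a set \<Rightarrow> 'a set \<Rightarrow> 'a set" where
  "centralizer_mod G W M = {g \<in> carrier G. \<forall>w\<in>W. comm G g w \<in> M}"

text \<open>\<open>H\<close> may be any set, since conjugacy classes and unions of two subgroups
  occur below. For conjugation-invariant \<open>H\<close>, passing to the generated subgroup leaves
  the series unchanged.\<close>

primrec rel_center :: "('a, 'b) monoid_scheme \<Rightarrow> 'a set \<Rightarrow> nat \<Rightarrow> 'a set" where
  "rel_center G H 0 = {\<one>\<^bsub>G\<^esub>}"
| "rel_center G H (Suc n) = centralizer_mod G H (rel_center G H n)"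

definition nilpotent_normal :: "('a, 'b) monoid_scheme \<Rightarrow> 'a set \<Rightarrow> bool" where
  "nilpotent_normal G N \<longleftrightarrow> N \<lhd> G \<and> (\<exists>n. N \<subseteq> rel_center G N n)"

context group
begin

abbreviation conj_closed :: "'a set \<Rightarrow> bool" where
  "conj_closed W \<equiv> W \<subseteq> carrier G \<and> (\<forall>x\<in>carrier G. \<forall>w\<in>W. x \<otimes> w \<otimes> inv x \<in> W)"

lemma normal_conj_closed: "N \<lhd> G \<Longrightarrow> conj_closed N"
  using normal_inv_iff subgroup.subset by blast

lemma normal_subset: "N \<lhd> G \<Longrightarrow> N \<subseteq> carrier G"
  using normal_conj_closed by blast

lemma normal_mem_carrier: "N \<lhd> G \<Longrightarrow> x \<in> N \<Longrightarrow> x \<in> carrier G"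
  using normal_subset by blast

lemma mult_inv_cancel [simp]:
  assumes "x \<in> carrier G" "y \<in> carrier G"
  shows "x \<otimes> (inv x \<otimes> y) = y" "inv x \<otimes> (x \<otimes> y) = y"
  using assms by (simp_all flip: m_assoc)

lemma comm_closed [simp]: "x \<in> carrier G \<Longrightarrow> y \<in> carrier G \<Longrightarrow> comm G x y \<in> carrier G"
  by (simp add: comm_def)

lemma inv_comm: "x \<in> carrier G \<Longrightarrow> y \<in> carrier G \<Longrightarrow> inv (comm G x y) = comm G y x"
  by (simp add: comm_def m_assoc inv_mult_group)

lemma conj_comm:
  "x \<in> carrier G \<Longrightarrow> g \<in> carrier G \<Longrightarrow> h \<in> carrier G \<Longrightarrow>
    x \<otimes> comm G g h \<otimes> inv x = comm G (x \<otimes> g \<otimes> inv x) (x \<otimes> h \<otimes> inv x)"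
  by (simp add: comm_def m_assoc inv_mult_group)

lemma comm_eq_one_iff:
  assumes "x \<in> carrier G" "y \<in> carrier G"
  shows "comm G x y = \<one> \<longleftrightarrow> x \<otimes> y = y \<otimes> x"
proof -
  have "comm G x y = (x \<otimes> y) \<otimes> inv (y \<otimes> x)"
    using assms by (simp add: comm_def m_assoc inv_mult_group)
  then show ?thesis
    using assms inv_solve_right'[of \<one> "x \<otimes> y" "y \<otimes> x"] by auto
qed

lemma hall_witt:
  assumes "x \<in> carrier G" "y \<in> carrier G" "z \<in> carrier G"
  shows "(x \<otimes> comm G y (comm G (inv x) z) \<otimes> inv x) \<otimes>
    (z \<otimes> comm G x (comm G (inv z) y) \<otimes> inv z) \<otimes>
    (y \<otimes> comm G z (comm G (inv y) x) \<otimes> inv y) = \<one>"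
  using assms by (simp add: comm_def m_assoc inv_mult_group)

lemma normal_conj_iff:
  assumes M: "M \<lhd> G" and "x \<in> carrier G" "g \<in> carrier G"
  shows "x \<otimes> g \<otimes> inv x \<in> M \<longleftrightarrow> g \<in> M"
proof
  assume "x \<otimes> g \<otimes> inv x \<in> M"
  then have "inv x \<otimes> (x \<otimes> g \<otimes> inv x) \<otimes> x \<in> M"
    using normal.inv_op_closed1[OF M] assms by blast
  then show "g \<in> M"
    using assms by (simp add: m_assoc)
qed (use assms normal.inv_op_closed2[OF M] in blast)

lemma comm_mem_swap:
  assumes "M \<lhd> G" "x \<in> carrier G" "y \<in> carrier G" "comm G x y \<in> M"
  shows "comm G y x \<in> M"
  using assms inv_comm normal_imp_subgroup subgroup.m_inv_closed by metis

lemma comm_mem_left: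
  assumes M: "M \<lhd> G" and "x \<in> M" "y \<in> carrier G"
  shows "comm G x y \<in> M"
proof -
  have x: "x \<in> carrier G" using assms normal_mem_carrier by blast
  have "y \<otimes> inv x \<otimes> inv y \<in> M"
    using assms normal.inv_op_closed2 normal_imp_subgroup subgroup.m_inv_closed by metis
  then have "x \<otimes> (y \<otimes> inv x \<otimes> inv y) \<in> M"
    using assms normal_imp_subgroup subgroup.m_closed by metis
  then show ?thesis
    using x assms by (simp add: comm_def m_assoc)
qed

lemma comm_mem_right: "M \<lhd> G \<Longrightarrow> x \<in> M \<Longrightarrow> y \<in> carrier G \<Longrightarrow> comm G y x \<in> M"
  by (meson comm_mem_left comm_mem_swap normal_mem_carrier)

section \<open>Centralizers modulo a normal subgroup\<close>

lemma centralizer_mod_subset: "centralizer_mod G W M \<subseteq> carrier G"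
  by (auto simp: centralizer_mod_def)

lemma centralizer_mod_mono:
  "W' \<subseteq> W \<Longrightarrow> M \<subseteq> M' \<Longrightarrow> centralizer_mod G W M \<subseteq> centralizer_mod G W' M'"
  by (auto simp: centralizer_mod_def)

text \<open>Closure comes from \<open>[g^-1, w] = g^-1 [w, g] g\<close> and
  \<open>[g h, w] = (g [h, w] g^-1) [g, w]\<close>; normality of \<open>M\<close> absorbs the
  conjugations.\<close>

lemma subgroup_centralizer_mod:
  assumes W: "W \<subseteq> carrier G" and M: "M \<lhd> G"
  shows "subgroup (centralizer_mod G W M) G"
proof (rule subgroupI)
  have M1: "\<one> \<in> M" and Mm: "\<And>x y. x \<in> M \<Longrightarrow> y \<in> M \<Longrightarrow> x \<otimes> y \<in> M"
    and Mi: "\<And>x. x \<in> M \<Longrightarrow> inv x \<in> M"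
    using normal_imp_subgroup[OF M]
    by (auto simp: subgroup.one_closed subgroup.m_closed subgroup.m_inv_closed)
  show "centralizer_mod G W M \<subseteq> carrier G"
    by (rule centralizer_mod_subset)
  have "\<one> \<in> centralizer_mod G W M"
    using W M1 by (auto simp: centralizer_mod_def comm_def subset_iff)
  then show "centralizer_mod G W M \<noteq> {}" by blast
  fix g assume g: "g \<in> centralizer_mod G W M"
  have gc: "g \<in> carrier G" using g by (simp add: centralizer_mod_def)
  show "inv g \<in> centralizer_mod G W M"
    unfolding centralizer_mod_def
  proof (intro CollectI conjI ballI)
    show "inv g \<in> carrier G" using gc by simp
    fix w assume w: "w \<in> W"
    then have wc: "w \<in> carrier G" using W by blast
    have "comm G g w \<in> M" using g w by (simp add: centralizer_mod_def)
    then have "inv g \<otimes> comm G w g \<otimes> inv (inv g) \<in> M"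
      using M gc wc by (metis comm_mem_swap inv_closed normal.inv_op_closed2)
    then show "comm G (inv g) w \<in> M"
      using gc wc by (simp add: comm_def m_assoc inv_mult_group)
  qed
  fix h assume h: "h \<in> centralizer_mod G W M"
  have hc: "h \<in> carrier G" using h by (simp add: centralizer_mod_def)
  show "g \<otimes> h \<in> centralizer_mod G W M"
    unfolding centralizer_mod_def
  proof (intro CollectI conjI ballI)
    show "g \<otimes> h \<in> carrier G" using gc hc by simp
    fix w assume w: "w \<in> W"
    then have wc: "w \<in> carrier G" using W by blast
    have "comm G g w \<in> M" "comm G h w \<in> M" using g h w by (auto simp: centralizer_mod_def)
    then have "(g \<otimes> comm G h w \<otimes> inv g) \<otimes> comm G g w \<in> M"
      using M gc by (metis Mm normal.inv_op_closed2)
    then show "comm G (g \<otimes> h) w \<in> M"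
      using gc hc wc by (simp add: comm_def m_assoc inv_mult_group)
  qed
qed

lemma normal_centralizer_mod:
  assumes W: "conj_closed W" and M: "M \<lhd> G"
  shows "centralizer_mod G W M \<lhd> G"
proof (rule normal_invI)
  show "subgroup (centralizer_mod G W M) G"
    by (rule subgroup_centralizer_mod) (use assms in auto)
  fix x g assume x: "x \<in> carrier G" and g: "g \<in> centralizer_mod G W M"
  have gc: "g \<in> carrier G" using g by (simp add: centralizer_mod_def)
  show "x \<otimes> g \<otimes> inv x \<in> centralizer_mod G W M"
    unfolding centralizer_mod_def
  proof (intro CollectI conjI ballI)
    show "x \<otimes> g \<otimes> inv x \<in> carrier G" using x gc by simp
    fix w assume w: "w \<in> W"
    then have wc: "w \<in> carrier G" using W by blast
    have "inv x \<otimes> w \<otimes> inv (inv x) \<in> W" using W w x inv_closed by blast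
    then have "comm G g (inv x \<otimes> w \<otimes> x) \<in> M"
      using g x by (simp add: centralizer_mod_def)
    then have "x \<otimes> comm G g (inv x \<otimes> w \<otimes> x) \<otimes> inv x \<in> M"
      using normal.inv_op_closed2[OF M x] by blast
    then show "comm G (x \<otimes> g \<otimes> inv x) w \<in> M"
      using gc x wc by (simp add: comm_def m_assoc inv_mult_group)
  qed
qed

lemma centralizer_mod_swap:
  assumes "A \<subseteq> carrier G" "M \<lhd> G" "B \<subseteq> centralizer_mod G A M"
  shows "A \<subseteq> centralizer_mod G B M"
  using assms comm_mem_swap by (auto simp: centralizer_mod_def subset_iff)

text \<open>After a swap, \<open>W\<close> lies in the subgroup
  \<open>centralizer_mod G ?R M\<close>, hence so does all that it generates; swapping back gives
  the harder inclusion.\<close>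

lemma centralizer_mod_generate:
  assumes W: "W \<subseteq> carrier G" and M: "M \<lhd> G"
  shows "centralizer_mod G (generate G W) M = centralizer_mod G W M" (is "?L = ?R")
proof
  show "?L \<subseteq> ?R"
    using generate.incl by (fastforce simp: centralizer_mod_def)
  have "W \<subseteq> centralizer_mod G ?R M"
    by (rule centralizer_mod_swap) (use W M in auto)
  then have "generate G W \<subseteq> centralizer_mod G ?R M"
    using generate_subgroup_incl subgroup_centralizer_mod[OF centralizer_mod_subset M] by metis
  then show "?R \<subseteq> ?L"
    by (rule centralizer_mod_swap[OF centralizer_mod_subset M])
qed

lemma normal_le_centralizer_mod:
  "M \<lhd> G \<Longrightarrow> W \<subseteq> carrier G \<Longrightarrow> M \<subseteq> centralizer_mod G W M"
  using comm_mem_left normal_mem_carrier by (auto simp: centralizer_mod_def subset_iff)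

text \<open>Modulo \<open>M\<close> two of the three factors in the Hall-Witt identity vanish, hence
  so does the third. Single commutators suffice, so no commutator subgroups are formed.\<close>

lemma three_subgroups:
  assumes A: "subgroup A G" and B: "subgroup B G" and C: "subgroup C G" and M: "M \<lhd> G"
    and BC: "\<And>b c. b \<in> B \<Longrightarrow> c \<in> C \<Longrightarrow> comm G b c \<in> centralizer_mod G A M"
    and CA: "\<And>c a. c \<in> C \<Longrightarrow> a \<in> A \<Longrightarrow> comm G c a \<in> centralizer_mod G B M"
    and a: "a \<in> A" and b: "b \<in> B"
  shows "comm G a b \<in> centralizer_mod G C M"
  unfolding centralizer_mod_def
proof (intro CollectI conjI ballI)
  have ac: "a \<in> carrier G" and bc: "b \<in> carrier G"
    using A B a b subgroup.mem_carrier by metis+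
  then show "comm G a b \<in> carrier G" by simp
  fix c assume c: "c \<in> C"
  have cc: "c \<in> carrier G" using C c subgroup.mem_carrier by metis
  have ai: "inv a \<in> A" and bi: "inv b \<in> B" and ci: "inv c \<in> C"
    using a b c A B C subgroup.m_inv_closed by metis+
  have "comm G (comm G (inv b) c) (inv a) \<in> M"
    using BC[OF bi c] ai by (simp add: centralizer_mod_def)
  then have 1: "comm G (inv a) (comm G (inv b) c) \<in> M"
    using M ac bc cc by (meson comm_mem_swap comm_closed inv_closed)
  have "comm G (comm G (inv c) (inv a)) b \<in> M"
    using CA[OF ci ai] b by (simp add: centralizer_mod_def)
  then have 2: "comm G b (comm G (inv c) (inv a)) \<in> M"
    using M ac bc cc by (meson comm_mem_swap comm_closed inv_closed)
  \<comment> \<open>The Hall-Witt identity at \<open>b\<close>, \<open>inv a\<close>,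
    \<open>c\<close>: its third factor \<open>?q\<close> is then a conjugate of
    \<open>comm G c (comm G a b)\<close>.\<close>
  let ?p = "(b \<otimes> comm G (inv a) (comm G (inv b) c) \<otimes> inv b) \<otimes>
    (c \<otimes> comm G b (comm G (inv c) (inv a)) \<otimes> inv c)"
  let ?q = "inv a \<otimes> comm G c (comm G a b) \<otimes> inv (inv a)"
  have p: "?p \<in> M"
    using 1 2 M bc cc normal.inv_op_closed2 normal_imp_subgroup subgroup.m_closed by metis
  have pq: "?p \<otimes> ?q = \<one>"
    using hall_witt[of b "inv a" c] ac bc cc by simp
  have pc: "?p \<in> carrier G" and qc: "?q \<in> carrier G"
    using ac bc cc by simp_all
  have "?q = inv ?p"
    using pq pc qc by (metis inv_equality inv_comm inv_inv)
  then have "?q \<in> M"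
    using p M normal_imp_subgroup subgroup.m_inv_closed by metis
  then have "comm G c (comm G a b) \<in> M"
    using normal_conj_iff[OF M, of "inv a"] ac bc cc by simp
  then show "comm G (comm G a b) c \<in> M"
    using M ac bc cc comm_mem_swap comm_closed by metis
qed

lemma normal_rel_center: "conj_closed H \<Longrightarrow> rel_center G H n \<lhd> G"
  by (induction n) (simp_all add: one_is_normal normal_centralizer_mod)

lemma rel_center_Suc_mono: "conj_closed H \<Longrightarrow> rel_center G H n \<subseteq> rel_center G H (Suc n)"
  using normal_le_centralizer_mod normal_rel_center by simp

lemma rel_center_mono: "conj_closed H \<Longrightarrow> m \<le> n \<Longrightarrow> rel_center G H m \<subseteq> rel_center G H n"
  using lift_Suc_mono_le[of "rel_center G H"] rel_center_Suc_mono by blast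

lemma rel_center_antimono: "H \<subseteq> H' \<Longrightarrow> rel_center G H' n \<subseteq> rel_center G H n"
  by (induction n) (simp_all add: centralizer_mod_mono)

lemma rel_center_generate:
  "conj_closed H \<Longrightarrow> rel_center G (generate G H) n = rel_center G H n"
  by (induction n) (simp_all add: centralizer_mod_generate normal_rel_center)

section \<open>Nilpotent normal subgroups and the Fitting subgroup\<close>

lemma comm_subgroup:
  assumes "subgroup N G" "x \<in> N" "y \<in> N"
  shows "comm (G\<lparr>carrier := N\<rparr>) x y = comm G x y"
  using assms by (simp add: comm_def m_inv_consistent)

lemma rel_center_subgroup:
  assumes "subgroup H G" "N \<subseteq> H"
  shows "rel_center (G\<lparr>carrier := H\<rparr>) N n = rel_center G N n \<inter> H"
proof (induction n)
  case 0
  then show ?case using assms subgroup.one_closed by auto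
next
  case (Suc n)
  have "comm G g h \<in> H" if "g \<in> H" "h \<in> N" for g h
    using that assms unfolding comm_def
    by (meson subgroup.m_closed subgroup.m_inv_closed subsetD)
  moreover have "comm (G\<lparr>carrier := H\<rparr>) g h = comm G g h" if "g \<in> H" "h \<in> N" for g h
    using that assms comm_subgroup by blast
  moreover have "H \<subseteq> carrier G"
    using assms subgroup.subset by blast
  ultimately show ?case
    by (auto simp: centralizer_mod_def Suc)
qed

lemma lower_central_subset: "lower_central G n \<subseteq> carrier G"
proof (induction n)
  case (Suc n)
  then show ?case
    by (simp, intro generate_incl) auto
qed simp

text \<open>If \<open>lower_central G n\<close> is trivial, then
  \<open>lower_central G (n - s)\<close> lies in the \<open>s\<close>-th upper term; if the
  \<open>n\<close>-th upper term is everything, then \<open>lower_central G i\<close> lies in the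
  upper term of index \<open>n - i\<close>.\<close>

lemma nilpotent_group_iff:
  "nilpotent_group G \<longleftrightarrow> (\<exists>n. carrier G \<subseteq> rel_center G (carrier G) n)"
proof
  assume "nilpotent_group G"
  then obtain n where n: "lower_central G n = {\<one>}"
    by (auto simp: nilpotent_group_def)
  have "lower_central G (n - s) \<subseteq> rel_center G (carrier G) s" if "s \<le> n" for s
    using that
  proof (induction s)
    case (Suc s)
    have "comm G x y \<in> rel_center G (carrier G) s"
      if x: "x \<in> lower_central G (n - Suc s)" and y: "y \<in> carrier G" for x y
    proof -
      have "comm G x y \<in> lower_central G (Suc (n - Suc s))"
        using x y by (auto simp: comm_def intro!: generate.incl)
      moreover have "Suc (n - Suc s) = n - s" using Suc.prems by simp
      ultimately show ?thesis using Suc by auto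
    qed
    then show ?case
      using lower_central_subset by (auto simp: centralizer_mod_def)
  qed (simp add: n)
  from this[of n] show "\<exists>n. carrier G \<subseteq> rel_center G (carrier G) n" by auto
next
  assume "\<exists>n. carrier G \<subseteq> rel_center G (carrier G) n"
  then obtain n where n: "carrier G \<subseteq> rel_center G (carrier G) n" by blast
  have "lower_central G i \<subseteq> rel_center G (carrier G) (n - i)" if "i \<le> n" for i
    using that
  proof (induction i)
    case (Suc i)
    then have "lower_central G i \<subseteq> rel_center G (carrier G) (Suc (n - Suc i))"
      by (simp add: Suc_diff_Suc)
    moreover have "subgroup (rel_center G (carrier G) (n - Suc i)) G"
      by (intro normal_imp_subgroup normal_rel_center) auto
    ultimately show ?case
      by (simp, intro generate_subgroup_incl) (auto simp: centralizer_mod_def comm_def)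
  qed (use n in simp)
  from this[of n] have "lower_central G n \<subseteq> {\<one>}" by simp
  moreover have "\<one> \<in> lower_central G n"
    by (cases n) (auto intro: generate.one)
  ultimately show "nilpotent_group G"
    using is_group by (auto simp: nilpotent_group_def)
qed

lemma nilpotent_subgroup_iff:
  assumes "subgroup N G"
  shows "nilpotent_group (G\<lparr>carrier := N\<rparr>) \<longleftrightarrow> (\<exists>n. N \<subseteq> rel_center G N n)"
  using group.nilpotent_group_iff[OF subgroup_imp_group[OF assms]]
  by (simp add: rel_center_subgroup[OF assms])

lemma nilpotent_normal_iff:
  "nilpotent_normal G N \<longleftrightarrow> N \<lhd> G \<and> nilpotent_group (G\<lparr>carrier := N\<rparr>)"
  using nilpotent_subgroup_iff normal_imp_subgroup by (auto simp: nilpotent_normal_def)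

lemma fitting_eq: "fitting G = generate G (\<Union>{N. nilpotent_normal G N})"
  by (simp add: fitting_def nilpotent_normal_iff)

text \<open>Normality puts \<open>[G, N]\<close> into \<open>N\<close>. One extra step thus absorbs
  all of \<open>G\<close>, so later arguments can start from the whole group.\<close>

lemma carrier_le_rel_center:
  assumes "N \<lhd> G" "N \<subseteq> rel_center G N n"
  shows "carrier G \<subseteq> rel_center G N (Suc n)"
  using assms comm_mem_right by (auto simp: centralizer_mod_def)

text \<open>Fitting's theorem: commuting an element of \<open>rel_center G M i \<inter> rel_center G N j\<close> with
  \<open>M\<close> or with \<open>N\<close> lowers one of the two indices.\<close>

lemma rel_center_Int_subset_Un:
  assumes M: "M \<lhd> G" and N: "N \<lhd> G"
  shows "rel_center G M i \<inter> rel_center G N j \<subseteq> rel_center G (M \<union> N) (i + j)"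
proof (induction "i + j" arbitrary: i j)
  case 0
  then show ?case by auto
next
  case (Suc k)
  have sub: "rel_center G M i' \<lhd> G" "rel_center G N i' \<lhd> G" for i'
    using normal_rel_center[OF normal_conj_closed[OF M]]
      normal_rel_center[OF normal_conj_closed[OF N]] by auto
  show ?case
  proof
    fix g assume g: "g \<in> rel_center G M i \<inter> rel_center G N j"
    then have gc: "g \<in> carrier G" using normal_mem_carrier[OF sub(1)] by blast
    have "comm G g h \<in> rel_center G (M \<union> N) k" if h: "h \<in> M \<union> N" for h
    proof -
      have hc: "h \<in> carrier G"
        using h normal_mem_carrier[OF M] normal_mem_carrier[OF N] by blast
      \<comment> \<open>If the index to be lowered is already \<open>0\<close>, then
        \<open>g = \<one>\<close> and the commutator is trivial.\<close>
      have gone: "comm G g h \<in> rel_center G (M \<union> N) k" if "g = \<one>"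
      proof -
        have "comm G g h = \<one>" using that hc by (simp add: comm_def)
        moreover have "conj_closed (M \<union> N)"
          using normal_conj_closed[OF M] normal_conj_closed[OF N] by blast
        ultimately show ?thesis
          using normal_rel_center normal_imp_subgroup subgroup.one_closed by metis
      qed
      from h show ?thesis
      proof
        assume hM: "h \<in> M"
        show ?thesis
        proof (cases i)
          case 0
          then show ?thesis using g gone by simp
        next
          case (Suc i')
          then have "comm G g h \<in> rel_center G M i'" using g hM by (simp add: centralizer_mod_def)
          moreover have "comm G g h \<in> rel_center G N j" using comm_mem_left[OF sub(2)] g hc by blast
          ultimately show ?thesis using Suc.hyps Suc by fastforce
        qed
      next
        assume hN: "h \<in> N"
        show ?thesis
        proof (cases j)
          case 0
          then show ?thesis using g gone by simp
        next
          case (Suc j')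
          then have "comm G g h \<in> rel_center G N j'" using g hN by (simp add: centralizer_mod_def)
          moreover have "comm G g h \<in> rel_center G M i" using comm_mem_left[OF sub(1)] g hc by blast
          ultimately show ?thesis using Suc.hyps Suc by fastforce
        qed
      qed
    qed
    then show "g \<in> rel_center G (M \<union> N) (i + j)"
      using gc by (simp add: centralizer_mod_def flip: Suc.hyps(2))
  qed
qed

text \<open>Both relative series reach \<open>G\<close> after one extra step, so by
  \<open>rel_center_Int_subset_Un\<close> the series relative to \<open>M \<union> N\<close> reaches
  it too.\<close>

lemma nilpotent_normal_join:
  assumes M: "nilpotent_normal G M" and N: "nilpotent_normal G N"
  shows "nilpotent_normal G (generate G (M \<union> N))"
proof -
  have MN: "M \<lhd> G" "N \<lhd> G" using M N by (auto simp: nilpotent_normal_def)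
  have cc: "conj_closed (M \<union> N)"
    using normal_conj_closed[OF MN(1)] normal_conj_closed[OF MN(2)] by blast
  obtain i j where "M \<subseteq> rel_center G M i" "N \<subseteq> rel_center G N j"
    using M N by (auto simp: nilpotent_normal_def)
  then have "carrier G \<subseteq> rel_center G M (Suc i) \<inter> rel_center G N (Suc j)"
    using MN carrier_le_rel_center by blast
  then have "carrier G \<subseteq> rel_center G (M \<union> N) (Suc i + Suc j)"
    using rel_center_Int_subset_Un[OF MN] by blast
  then have "generate G (M \<union> N) \<subseteq> rel_center G (generate G (M \<union> N)) (Suc i + Suc j)"
    using rel_center_generate[OF cc] generate_incl[of "M \<union> N"] cc by blast
  moreover have "generate G (M \<union> N) \<lhd> G"
    by (rule normal_generateI) (use cc in auto)
  ultimately show ?thesis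
    unfolding nilpotent_normal_def by blast
qed

lemma nilpotent_normal_one: "nilpotent_normal G {\<one>}"
  using one_is_normal by (auto simp: nilpotent_normal_def intro: exI[of _ 0])

lemma nilpotent_normal_finite_join:
  assumes "finite \<N>" "\<And>N. N \<in> \<N> \<Longrightarrow> nilpotent_normal G N"
  shows "\<exists>M. nilpotent_normal G M \<and> \<Union>\<N> \<subseteq> M"
  using assms
proof (induction \<N>)
  case (insert N \<N>)
  then obtain M where "nilpotent_normal G M" "\<Union>\<N> \<subseteq> M" by auto
  then have "nilpotent_normal G (generate G (N \<union> M))" "\<Union>(insert N \<N>) \<subseteq> generate G (N \<union> M)"
    using insert nilpotent_normal_join by (auto intro: generate.incl)
  then show ?case by blast
qed (use nilpotent_normal_one in auto)

text \<open>By \<open>nilpotent_normal_join\<close> the union is directed, hence already a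
  subgroup.\<close>

lemma fitting_eq_Union: "fitting G = \<Union>{N. nilpotent_normal G N}" (is "_ = ?U")
proof -
  have normal: "N \<lhd> G" if "nilpotent_normal G N" for N
    using that by (simp add: nilpotent_normal_def)
  have "subgroup ?U G"
  proof (rule subgroupI)
    show "?U \<subseteq> carrier G" using normal_subset[OF normal] by blast
    show "?U \<noteq> {}" using nilpotent_normal_one by blast
  next
    fix a assume "a \<in> ?U"
    then obtain N where N: "nilpotent_normal G N" "a \<in> N" by blast
    then have "inv a \<in> N"
      using subgroup.m_inv_closed[OF normal_imp_subgroup[OF normal[OF N(1)]]] by blast
    then show "inv a \<in> ?U" using N by blast
  next
    fix a b assume "a \<in> ?U" "b \<in> ?U"
    then obtain M N where M: "nilpotent_normal G M" "a \<in> M" and N: "nilpotent_normal G N" "b \<in> N"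
      by blast
    have "a \<otimes> b \<in> generate G (M \<union> N)"
      using M N by (intro generate.eng generate.incl) auto
    then show "a \<otimes> b \<in> ?U" using nilpotent_normal_join[OF M(1) N(1)] by blast
  qed
  then have "generate G ?U \<subseteq> ?U"
    by (rule generate_subgroup_incl[OF subset_refl])
  moreover have "?U \<subseteq> generate G ?U"
    by (intro subsetI generate.incl)
  ultimately show ?thesis
    by (simp add: fitting_eq)
qed

lemma normal_fitting: "fitting G \<lhd> G"
  unfolding fitting_eq
proof (rule normal_generateI)
  show "\<Union>{N. nilpotent_normal G N} \<subseteq> carrier G"
    using normal_subset by (auto simp: nilpotent_normal_def)
next
  fix h g assume "h \<in> \<Union>{N. nilpotent_normal G N}" and g: "g \<in> carrier G"
  then obtain N where N: "nilpotent_normal G N" "h \<in> N" by blast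
  then have "g \<otimes> h \<otimes> inv g \<in> N"
    using normal.inv_op_closed2[OF _ g] by (simp add: nilpotent_normal_def)
  then show "g \<otimes> h \<otimes> inv g \<in> \<Union>{N. nilpotent_normal G N}"
    using N by blast
qed

lemma finite_subset_fitting:
  assumes "finite S" "S \<subseteq> fitting G"
  shows "\<exists>N. nilpotent_normal G N \<and> S \<subseteq> N"
proof -
  have "\<forall>s\<in>S. \<exists>N. nilpotent_normal G N \<and> s \<in> N"
    using assms by (auto simp: fitting_eq_Union)
  then obtain N where N: "\<And>s. s \<in> S \<Longrightarrow> nilpotent_normal G (N s) \<and> s \<in> N s" by metis
  have "\<exists>M. nilpotent_normal G M \<and> \<Union>(N ` S) \<subseteq> M"
    using nilpotent_normal_finite_join[of "N ` S"] assms N by blast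
  then show ?thesis using N by blast
qed

section \<open>Nilpotency of the Fitting subgroup under the chain condition\<close>

abbreviation cent :: "'a set \<Rightarrow> 'a set" where
  "cent A \<equiv> centralizer_mod G A {\<one>}"

lemma centralizer_eq: "A \<subseteq> carrier G \<Longrightarrow> centralizer G A = cent A"
  using comm_eq_one_iff by (auto simp: centralizer_def centralizer_mod_def subset_iff)

lemma cent_swap: "A \<subseteq> carrier G \<Longrightarrow> B \<subseteq> cent A \<Longrightarrow> A \<subseteq> cent B"
  by (rule centralizer_mod_swap[OF _ one_is_normal])

lemma cent_cent_cent:
  assumes "A \<subseteq> carrier G"
  shows "cent (cent (cent A)) = cent A"
proof
  show "cent A \<subseteq> cent (cent (cent A))"
    by (rule cent_swap[OF centralizer_mod_subset]) simp
  show "cent (cent (cent A)) \<subseteq> cent A"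
    using cent_swap[OF assms, of "cent A"] by (simp add: centralizer_mod_mono)
qed

lemma MC_group_minimal:
  assumes MC: "MC_group G" and "\<A> \<noteq> {}" and sub: "\<And>A. A \<in> \<A> \<Longrightarrow> A \<subseteq> carrier G"
  obtains A where "A \<in> \<A>" "\<And>B. B \<in> \<A> \<Longrightarrow> cent B \<subseteq> cent A \<Longrightarrow> cent B = cent A"
proof -
  define r where "r = {(B, A). A \<subseteq> carrier G \<and> B \<subseteq> carrier G \<and> cent B \<subset> cent A}"
  have "\<nexists>f. \<forall>i. (f (Suc i), f i) \<in> r"
  proof
    assume "\<exists>f. \<forall>i. (f (Suc i), f i) \<in> r"
    then obtain f where f: "\<And>i. (f (Suc i), f i) \<in> r" by blast
    then have c: "f i \<subseteq> carrier G" for i by (auto simp: r_def)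
    have "centralizer G (f (Suc i)) \<subset> centralizer G (f i)" for i
      using f[of i] by (simp add: r_def centralizer_eq)
    then show False using MC c unfolding MC_group_def by blast
  qed
  then have "wf r" by (simp add: wf_iff_no_infinite_down_chain)
  then obtain A where A: "A \<in> \<A>" "\<And>B. (B, A) \<in> r \<Longrightarrow> B \<notin> \<A>"
    using \<open>\<A> \<noteq> {}\<close> by (metis wfE_min')
  have "cent B = cent A" if "B \<in> \<A>" "cent B \<subseteq> cent A" for B
    using that A sub[of A] sub[of B] unfolding r_def by blast
  then show ?thesis by (rule that[OF A(1)])
qed

text \<open>Taking centralizers reverses inclusions and is an involution on centralizers, so a
  minimal double centralizer yields a maximal centralizer.\<close>

lemma MC_group_maximal:
  assumes MC: "MC_group G" and "\<A> \<noteq> {}" and sub: "\<And>A. A \<in> \<A> \<Longrightarrow> A \<subseteq> carrier G"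
  obtains A where "A \<in> \<A>" "\<And>B. B \<in> \<A> \<Longrightarrow> cent A \<subseteq> cent B \<Longrightarrow> cent B = cent A"
proof -
  obtain C where "C \<in> cent ` \<A>"
    and C: "\<And>B. B \<in> cent ` \<A> \<Longrightarrow> cent B \<subseteq> cent C \<Longrightarrow> cent B = cent C"
    using MC_group_minimal[OF MC, of "cent ` \<A>"] \<open>\<A> \<noteq> {}\<close> centralizer_mod_subset by blast
  then obtain A where A: "A \<in> \<A>" "C = cent A" by blast
  have "cent B = cent A" if B: "B \<in> \<A>" "cent A \<subseteq> cent B" for B
  proof -
    have "cent (cent B) = cent (cent A)"
      using C[of "cent B"] B A centralizer_mod_mono[of "cent A" "cent B"] by blast
    then show ?thesis using cent_cent_cent sub A B by metis
  qed
  then show ?thesis using that A by blast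
qed

text \<open>Take a finite set \<open>A\<close> with minimal centralizer: adjoining any
  \<open>g\<close> cannot shrink \<open>cent A\<close>, so \<open>cent A\<close> commutes with every
  \<open>g\<close>.\<close>

lemma MC_group_finite_cent:
  assumes MC: "MC_group G"
  obtains A where "finite A" "A \<subseteq> carrier G" "cent A = cent (carrier G)"
proof -
  let ?\<A> = "{A. finite A \<and> A \<subseteq> carrier G}"
  have "{} \<in> ?\<A>" by simp
  then obtain A where A: "A \<in> ?\<A>"
    and min: "\<And>B. B \<in> ?\<A> \<Longrightarrow> cent B \<subseteq> cent A \<Longrightarrow> cent B = cent A"
    using MC_group_minimal[OF MC, of ?\<A>] by (metis (lifting) empty_iff mem_Collect_eq)
  have "cent A \<subseteq> cent {g}" if g: "g \<in> carrier G" for g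
  proof -
    have "cent (insert g A) = cent A"
      by (rule min) (use A g in \<open>auto simp: centralizer_mod_def\<close>)
    then show ?thesis using centralizer_mod_mono[of "{g}" "insert g A"] by blast
  qed
  then have "cent A \<subseteq> cent (carrier G)"
    by (fastforce simp: centralizer_mod_def)
  moreover have "cent (carrier G) \<subseteq> cent A"
    using A by (intro centralizer_mod_mono) auto
  ultimately show ?thesis using that[of A] A by blast
qed

section \<open>Normal subgroups outside the upper central series\<close>

abbreviation hyper :: "nat \<Rightarrow> 'a set" where
  "hyper \<equiv> rel_center G (carrier G)"

lemma normal_hyper: "hyper n \<lhd> G"
  by (rule normal_rel_center) simp

definition non_hyper :: "'a set \<Rightarrow> bool" where
  "non_hyper U \<longleftrightarrow> U \<lhd> G \<and> (\<forall>j. \<not> U \<subseteq> hyper j)"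

text \<open>The groups \<open>U \<inter> rel_center G N s\<close> grow from the trivial group to
  \<open>U\<close>. The first that lies in no \<open>hyper j\<close> serves as \<open>V\<close>:
  commuting with \<open>N\<close> sends it into its predecessor, which does lie in some
  \<open>hyper j\<close>.\<close>

lemma non_hyper_descend:
  assumes U: "non_hyper U" and N: "nilpotent_normal G N"
  obtains V j where "non_hyper V" "V \<subseteq> U" "N \<subseteq> centralizer_mod G V (hyper j)"
proof -
  have Nn: "N \<lhd> G" using N by (simp add: nilpotent_normal_def)
  have Un: "U \<lhd> G" using U by (simp add: non_hyper_def)
  let ?V = "\<lambda>s. U \<inter> rel_center G N s"
  have Vn: "?V s \<lhd> G" for s
    by (rule normal_subgroup_intersect[OF Un normal_rel_center[OF normal_conj_closed[OF Nn]]])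
  obtain n where "carrier G \<subseteq> rel_center G N n"
    using N carrier_le_rel_center[OF Nn] unfolding nilpotent_normal_def by blast
  then have "?V n = U" using normal_subset[OF Un] by blast
  then have "\<not> (\<exists>j. ?V n \<subseteq> hyper j)" using U by (simp add: non_hyper_def)
  moreover have "?V 0 \<subseteq> hyper 0" by auto
  ultimately obtain s where s: "\<exists>j. ?V s \<subseteq> hyper j" "\<not> (\<exists>j. ?V (Suc s) \<subseteq> hyper j)"
    using ex_least_nat_less[of "\<lambda>s. \<not> (\<exists>j. ?V s \<subseteq> hyper j)" n] by blast
  then obtain j where j: "?V s \<subseteq> hyper j" by blast
  have "comm G v x \<in> hyper j" if "v \<in> ?V (Suc s)" "x \<in> N" for v x
  proof -
    have "comm G v x \<in> U"
      using that comm_mem_left[OF Un] normal_mem_carrier[OF Nn] by blast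
    moreover have "comm G v x \<in> rel_center G N s"
      using that by (simp add: centralizer_mod_def)
    ultimately show ?thesis using j by blast
  qed
  then have "?V (Suc s) \<subseteq> centralizer_mod G N (hyper j)"
    using normal_subset[OF Un] by (auto simp: centralizer_mod_def)
  then have "N \<subseteq> centralizer_mod G (?V (Suc s)) (hyper j)"
    by (rule centralizer_mod_swap[OF normal_subset[OF Nn] normal_hyper])
  moreover have "non_hyper (?V (Suc s))"
    unfolding non_hyper_def using s(2) Vn by blast
  ultimately show ?thesis using that by blast
qed

text \<open>If \<open>V'\<close> were inside \<open>hyper j\<close>, then \<open>V\<close> would be
  inside \<open>hyper (Suc j)\<close>.\<close>

lemma non_hyper_commutators:
  assumes V: "non_hyper V"
  defines "V' \<equiv> generate G {comm G v g | v g. v \<in> V \<and> g \<in> carrier G}"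
  shows "non_hyper V'" "V' \<subseteq> V"
proof -
  let ?S = "{comm G v g | v g. v \<in> V \<and> g \<in> carrier G}"
  have Vn: "V \<lhd> G" using V by (simp add: non_hyper_def)
  have S: "?S \<subseteq> V" using Vn comm_mem_left by auto
  then show "V' \<subseteq> V"
    unfolding V'_def using generate_subgroup_incl normal_imp_subgroup[OF Vn] by blast
  have "V' \<lhd> G"
    unfolding V'_def
  proof (rule normal_generateI)
    show "?S \<subseteq> carrier G" using S normal_subset[OF Vn] by blast
    fix h g assume "h \<in> ?S" and g: "g \<in> carrier G"
    then obtain v k where vk: "h = comm G v k" "v \<in> V" "k \<in> carrier G" by blast
    have "g \<otimes> h \<otimes> inv g = comm G (g \<otimes> v \<otimes> inv g) (g \<otimes> k \<otimes> inv g)"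
      using vk g normal_mem_carrier[OF Vn] by (simp add: conj_comm)
    moreover have "g \<otimes> v \<otimes> inv g \<in> V"
      using vk g normal.inv_op_closed2[OF Vn] by blast
    ultimately show "g \<otimes> h \<otimes> inv g \<in> ?S"
      using vk g by blast
  qed
  moreover have "\<not> V' \<subseteq> hyper j" for j
  proof
    assume "V' \<subseteq> hyper j"
    then have "?S \<subseteq> hyper j" unfolding V'_def using generate.incl[of _ ?S G] by blast
    then have "V \<subseteq> hyper (Suc j)"
      using normal_subset[OF Vn] by (auto simp: centralizer_mod_def)
    then show False using V unfolding non_hyper_def by blast
  qed
  ultimately show "non_hyper V'" by (simp add: non_hyper_def)
qed

text \<open>Each induction step replaces \<open>V\<close> by its commutator subgroup with
  \<open>G\<close>. Three subgroups \<open>V\<close>, \<open>G\<close>, \<open>X\<close> modulo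
  \<open>hyper j\<close>: \<open>[G, X]\<close> lies in \<open>cent U\<close> and so centralizes
  \<open>V\<close>, while \<open>[X, V]\<close> lies in \<open>hyper (Suc j)\<close>, which
  \<open>G\<close> moves into \<open>hyper j\<close>. At \<open>j = 0\<close>, \<open>X\<close>
  centralizes \<open>V\<close> and \<open>max\<close> applies.\<close>

lemma central_modulo_cent:
  assumes U: "U \<lhd> G"
    and max: "\<And>V. non_hyper V \<Longrightarrow> V \<subseteq> U \<Longrightarrow> cent V \<subseteq> cent U"
    and X: "X \<lhd> G"
    and XG: "\<And>x g. x \<in> X \<Longrightarrow> g \<in> carrier G \<Longrightarrow> comm G x g \<in> cent U"
    and V: "non_hyper V" "V \<subseteq> U" "X \<subseteq> centralizer_mod G V (hyper j)"
  shows "X \<subseteq> cent U"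
  using V
proof (induction j arbitrary: V)
  case 0
  then show ?case using max[of V] by simp
next
  case (Suc j)
  let ?S = "{comm G v g | v g. v \<in> V \<and> g \<in> carrier G}"
  have Vn: "V \<lhd> G" using Suc.prems by (simp add: non_hyper_def)
  have Un: "cent U \<lhd> G"
    using normal_centralizer_mod[OF normal_conj_closed[OF U] one_is_normal] .
  have one: "\<one> \<in> hyper j"
    using normal_hyper normal_imp_subgroup subgroup.one_closed by metis
  have VX: "comm G v g \<in> centralizer_mod G X (hyper j)" if "v \<in> V" "g \<in> carrier G" for v g
  proof (rule three_subgroups[OF normal_imp_subgroup[OF Vn] subgroup_self
        normal_imp_subgroup[OF X] normal_hyper _ _ that])
    fix g x assume "g \<in> carrier G" "x \<in> X"
    then have "comm G g x \<in> cent U"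
      using XG comm_mem_swap[OF Un] normal_mem_carrier[OF X] by blast
    then show "comm G g x \<in> centralizer_mod G V (hyper j)"
      using centralizer_mod_mono[OF Suc.prems(2), of "{\<one>}" "hyper j"] one by blast
  next
    fix x v assume "x \<in> X" "v \<in> V"
    then show "comm G x v \<in> centralizer_mod G (carrier G) (hyper j)"
      using Suc.prems(3) by (auto simp: centralizer_mod_def[of G V])
  qed
  have "X \<subseteq> centralizer_mod G ?S (hyper j)"
    by (rule centralizer_mod_swap[OF normal_subset[OF X] normal_hyper]) (use VX in blast)
  moreover have "?S \<subseteq> carrier G"
    using normal_mem_carrier[OF Vn] by auto
  ultimately have "X \<subseteq> centralizer_mod G (generate G ?S) (hyper j)"
    using normal_hyper by (simp add: centralizer_mod_generate)
  then show ?case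
    using Suc.IH non_hyper_commutators[OF Suc.prems(1)] Suc.prems(2) by blast
qed

text \<open>The subgroups \<open>hyper_stabilizer i\<close> take the place of the lower central series: they contain
  its terms, and \<open>hyper_stabilizer i\<close> centralizes \<open>hyper i\<close>.\<close>

definition hyper_stabilizer :: "nat \<Rightarrow> 'a set" where
  "hyper_stabilizer i = (\<Inter>l. centralizer_mod G (hyper (i + l)) (hyper l))"

lemma subgroup_hyper_stabilizer: "subgroup (hyper_stabilizer i) G"
  unfolding hyper_stabilizer_def
proof (rule subgroups_Inter)
  fix H assume "H \<in> range (\<lambda>l. centralizer_mod G (hyper (i + l)) (hyper l))"
  then show "subgroup H G"
    using subgroup_centralizer_mod[OF normal_subset[OF normal_hyper] normal_hyper] by auto
qed auto

lemma normal_hyper_stabilizer: "hyper_stabilizer i \<lhd> G"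
proof (rule normal_invI[OF subgroup_hyper_stabilizer])
  fix x h assume "x \<in> carrier G" "h \<in> hyper_stabilizer i"
  then show "x \<otimes> h \<otimes> inv x \<in> hyper_stabilizer i"
    using normal.inv_op_closed2[OF normal_centralizer_mod[OF
        normal_conj_closed[OF normal_hyper] normal_hyper]]
    by (auto simp: hyper_stabilizer_def)
qed

text \<open>Three subgroups modulo \<open>hyper l\<close>: an element of
  \<open>hyper (Suc i + l)\<close> reaches \<open>hyper l\<close> whether it is commuted first with
  \<open>G\<close> and then with \<open>hyper_stabilizer i\<close>, or in the opposite
  order.\<close>

lemma comm_hyper_stabilizer:
  assumes "x \<in> hyper_stabilizer i" "g \<in> carrier G"
  shows "comm G x g \<in> hyper_stabilizer (Suc i)"
  unfolding hyper_stabilizer_def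
proof (rule INT_I)
  fix l
  show "comm G x g \<in> centralizer_mod G (hyper (Suc i + l)) (hyper l)"
  proof (rule three_subgroups[OF subgroup_hyper_stabilizer subgroup_self
        normal_imp_subgroup[OF normal_hyper] normal_hyper _ _ assms])
    fix g z assume g: "g \<in> carrier G" and z: "z \<in> hyper (Suc i + l)"
    then have "comm G z g \<in> hyper (i + l)"
      by (simp add: centralizer_mod_def)
    then have "comm G g z \<in> hyper (i + l)"
      using comm_mem_swap[OF normal_hyper] g z normal_mem_carrier[OF normal_hyper] by blast
    moreover have "hyper (i + l) \<subseteq> centralizer_mod G (hyper_stabilizer i) (hyper l)"
      by (rule centralizer_mod_swap[OF normal_subset[OF normal_hyper] normal_hyper])
        (auto simp: hyper_stabilizer_def)
    ultimately show "comm G g z \<in> centralizer_mod G (hyper_stabilizer i) (hyper l)"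
      by blast
  next
    fix z x assume z: "z \<in> hyper (Suc i + l)" and x: "x \<in> hyper_stabilizer i"
    have "x \<in> centralizer_mod G (hyper (i + Suc l)) (hyper (Suc l))"
      using x unfolding hyper_stabilizer_def by blast
    moreover have "z \<in> hyper (i + Suc l)"
      using z by simp
    ultimately have "x \<in> carrier G" "comm G x z \<in> hyper (Suc l)"
      unfolding centralizer_mod_def by blast+
    then have "comm G z x \<in> hyper (Suc l)"
      using comm_mem_swap[OF normal_hyper] z normal_mem_carrier[OF normal_hyper] by blast
    then show "comm G z x \<in> centralizer_mod G (carrier G) (hyper l)"
      by simp
  qed
qed

lemma hyper_stabilizer_0: "hyper_stabilizer 0 = carrier G"
  unfolding hyper_stabilizer_def
  using comm_mem_right[OF normal_hyper] by (auto simp: centralizer_mod_def)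

lemma hyper_stabilizer_subset_cent: "hyper_stabilizer i \<subseteq> cent (hyper i)"
  unfolding hyper_stabilizer_def by (rule INF_lower2[of 0]) auto

lemma exists_central_modulo_cent:
  assumes MC: "MC_group G"
    and loc: "\<And>S. finite S \<Longrightarrow> S \<subseteq> carrier G \<Longrightarrow> \<exists>N. nilpotent_normal G N \<and> S \<subseteq> N"
    and U: "non_hyper U"
    and max: "\<And>V. non_hyper V \<Longrightarrow> V \<subseteq> U \<Longrightarrow> cent V \<subseteq> cent U"
  obtains X V j where "X \<lhd> G" "\<And>x g. x \<in> X \<Longrightarrow> g \<in> carrier G \<Longrightarrow> comm G x g \<in> cent U"
    "\<not> X \<subseteq> cent U" "non_hyper V" "V \<subseteq> U" "X \<subseteq> centralizer_mod G V (hyper j)"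
proof -
  have Un: "U \<lhd> G" using U by (simp add: non_hyper_def)
  have Cn: "cent U \<lhd> G"
    using normal_centralizer_mod[OF normal_conj_closed[OF Un] one_is_normal] .
  \<comment> \<open>\<open>Z\<close> is the upper central term with smallest centralizer; hence
    \<open>cent Z\<close> centralizes every \<open>hyper j\<close>.\<close>
  have "range hyper \<noteq> {}" by blast
  then obtain Z where "Z \<in> range hyper"
    and Z: "\<And>B. B \<in> range hyper \<Longrightarrow> cent B \<subseteq> cent Z \<Longrightarrow> cent B = cent Z"
    using MC_group_minimal[OF MC, of "range hyper"] normal_subset[OF normal_hyper]
    by (metis imageE)
  then obtain j0 where j0: "Z = hyper j0" by blast
  have D: "cent Z \<subseteq> cent (hyper j)" for j
  proof (cases "j \<le> j0")
    case True
    then have "hyper j \<subseteq> Z" unfolding j0 by (intro rel_center_mono) auto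
    then show ?thesis by (intro centralizer_mod_mono) auto
  next
    case False
    then have "Z \<subseteq> hyper j" unfolding j0 by (intro rel_center_mono) auto
    then show ?thesis using Z[of "hyper j"] centralizer_mod_mono[of Z "hyper j"] by blast
  qed
  have DC: "hyper j \<subseteq> centralizer_mod G X {\<one>}" if "X \<subseteq> cent Z" for j X
    using that D[of j] by (intro cent_swap[OF normal_subset[OF normal_hyper]]) blast
  have Dn: "cent Z \<lhd> G"
    unfolding j0 using normal_centralizer_mod[OF normal_conj_closed[OF normal_hyper] one_is_normal] .
  show ?thesis
  proof (cases "cent Z \<subseteq> cent U")
    case True
    \<comment> \<open>The stabilizers descend from \<open>G\<close> into \<open>cent Z\<close>,
      hence into \<open>cent U\<close>; the last one outside \<open>cent U\<close> is central modulo
      \<open>cent U\<close>.\<close>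
    have "\<not> hyper_stabilizer 0 \<subseteq> cent U"
      unfolding hyper_stabilizer_0
    proof
      assume "carrier G \<subseteq> cent U"
      then have "U \<subseteq> cent (carrier G)" by (rule cent_swap[OF normal_subset[OF Un]])
      then have "U \<subseteq> hyper 1" by simp
      then show False using U unfolding non_hyper_def by blast
    qed
    moreover have "hyper_stabilizer j0 \<subseteq> cent U"
      using hyper_stabilizer_subset_cent[of j0] True j0 by blast
    ultimately obtain i where i: "\<not> hyper_stabilizer i \<subseteq> cent U"
      "hyper_stabilizer (Suc i) \<subseteq> cent U"
      using ex_least_nat_less[of "\<lambda>i. hyper_stabilizer i \<subseteq> cent U" j0]
      by blast
    \<comment> \<open>Intersecting with \<open>N\<close> secures
      \<open>[V, X] \<subseteq> hyper j\<close>; taking \<open>N\<close> around \<open>x\<close>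
      keeps the intersection outside \<open>cent U\<close>.\<close>
    then obtain x where x: "x \<in> hyper_stabilizer i" "x \<notin> cent U" by blast
    then have "x \<in> carrier G" using normal_mem_carrier[OF normal_hyper_stabilizer] by blast
    then obtain N where N: "nilpotent_normal G N" "x \<in> N"
      using loc[of "{x}"] by auto
    then have Nn: "N \<lhd> G" by (simp add: nilpotent_normal_def)
    obtain V j where V: "non_hyper V" "V \<subseteq> U" "N \<subseteq> centralizer_mod G V (hyper j)"
      using non_hyper_descend[OF U N(1)] .
    show ?thesis
    proof (rule that[of "hyper_stabilizer i \<inter> N" V j])
      show "hyper_stabilizer i \<inter> N \<lhd> G"
        by (rule normal_subgroup_intersect[OF normal_hyper_stabilizer Nn])
      show "comm G x g \<in> cent U" if "x \<in> hyper_stabilizer i \<inter> N" "g \<in> carrier G" for x g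
        using that comm_hyper_stabilizer i by blast
    qed (use x N V in auto)
  next
    case False
    \<comment> \<open>Since \<open>N\<close> contains the finite set \<open>A\<close>, its
      centralizer is no larger than the center \<open>hyper 1\<close>.\<close>
    obtain A where A: "finite A" "A \<subseteq> carrier G" "cent A = cent (carrier G)"
      using MC_group_finite_cent[OF MC] .
    obtain N where N: "nilpotent_normal G N" "A \<subseteq> N"
      using loc[OF A(1,2)] by blast
    have Nn: "N \<lhd> G" using N by (simp add: nilpotent_normal_def)
    have NZ: "cent N \<subseteq> hyper 1"
      using centralizer_mod_mono[OF N(2), of "{\<one>}" "{\<one>}"] A by simp
    obtain V j where V: "non_hyper V" "V \<subseteq> U" "N \<subseteq> centralizer_mod G V (hyper j)"
      using non_hyper_descend[OF U N(1)] .
    have Vn: "V \<lhd> G" using V by (simp add: non_hyper_def)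
    have UV: "cent U \<subseteq> cent V"
      using V by (intro centralizer_mod_mono) auto
    \<comment> \<open>These groups climb from the trivial group to \<open>cent Z\<close>;
      \<open>X\<close> is the first one outside \<open>cent U\<close>, so \<open>[X, N]\<close>
      falls into \<open>cent U\<close>.\<close>
    let ?X = "\<lambda>s. cent Z \<inter> rel_center G N s"
    have Xn: "?X s \<lhd> G" for s
      by (rule normal_subgroup_intersect[OF Dn normal_rel_center[OF normal_conj_closed[OF Nn]]])
    obtain n where "carrier G \<subseteq> rel_center G N n"
      using N carrier_le_rel_center[OF Nn] unfolding nilpotent_normal_def by blast
    then have "\<not> ?X n \<subseteq> cent U"
      using False centralizer_mod_subset[of Z] by blast
    moreover have "?X 0 \<subseteq> cent U"
      using subgroup.one_closed[OF normal_imp_subgroup[OF Cn]] by auto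
    ultimately obtain s where s: "?X s \<subseteq> cent U" "\<not> ?X (Suc s) \<subseteq> cent U"
      using ex_least_nat_less[of "\<lambda>s. \<not> ?X s \<subseteq> cent U" n] by blast
    define X where "X = ?X (Suc s)"
    have X: "X \<lhd> G" "X \<subseteq> cent Z" "\<not> X \<subseteq> cent U"
      using Xn[of "Suc s"] s(2) unfolding X_def by blast+
    have XN: "comm G x y \<in> cent U" if "x \<in> X" "y \<in> N" for x y
    proof -
      have "comm G x y \<in> cent Z"
        using that X comm_mem_left[OF Dn] normal_mem_carrier[OF Nn] by blast
      moreover have "comm G x y \<in> rel_center G N s"
        using that by (simp add: X_def centralizer_mod_def[of G N])
      ultimately show ?thesis using s by blast
    qed
    \<comment> \<open>\<open>[X, N]\<close> lies in \<open>cent U\<close> and so centralizes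
      \<open>V\<close>; \<open>[N, V]\<close> lies in \<open>hyper j\<close>, which commutes with
      \<open>X\<close> because \<open>X \<subseteq> cent Z\<close>.\<close>
    have VX: "comm G v x \<in> cent N" if "v \<in> V" "x \<in> X" for v x
    proof (rule three_subgroups[OF normal_imp_subgroup[OF Vn] normal_imp_subgroup[OF X(1)]
          normal_imp_subgroup[OF Nn] one_is_normal _ _ that])
      fix x y assume "x \<in> X" "y \<in> N"
      then show "comm G x y \<in> cent V" using XN UV by blast
    next
      fix y v assume "y \<in> N" "v \<in> V"
      then have "comm G y v \<in> hyper j"
        using V(3) by (auto simp: centralizer_mod_def)
      then show "comm G y v \<in> cent X"
        using DC[OF X(2)] by blast
    qed
    have VX1: "comm G v x \<in> hyper 1" if "v \<in> V" "x \<in> X" for v x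
      using VX[OF that] NZ by blast
    have "V \<subseteq> centralizer_mod G X (hyper 1)"
      using VX1 normal_subset[OF Vn] unfolding centralizer_mod_def by blast
    then have XV: "X \<subseteq> centralizer_mod G V (hyper 1)"
      by (rule centralizer_mod_swap[OF normal_subset[OF X(1)] normal_hyper])
    show ?thesis
    proof (rule that[OF X(1) _ X(3) V(1,2) XV])
      fix x g assume x: "x \<in> X" and g: "g \<in> carrier G"
      then obtain M where M: "nilpotent_normal G M" "g \<in> M"
        using loc[of "{g}"] by auto
      have Mn: "M \<lhd> G" using M by (simp add: nilpotent_normal_def)
      obtain W k where W: "non_hyper W" "W \<subseteq> V" "M \<subseteq> centralizer_mod G W (hyper k)"
        using non_hyper_descend[OF V(1) M(1)] .
      have Wn: "W \<lhd> G" using W by (simp add: non_hyper_def)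
      \<comment> \<open>Here \<open>W\<close> depends on \<open>g\<close>. \<open>[M, W]\<close>
        lies in \<open>hyper k\<close> and commutes with \<open>X\<close>, and \<open>[W, X]\<close>
        is central; \<open>max\<close> then passes from \<open>cent W\<close> to
        \<open>cent U\<close>.\<close>
      have "comm G x g \<in> cent W"
      proof (rule three_subgroups[OF normal_imp_subgroup[OF X(1)] normal_imp_subgroup[OF Mn]
            normal_imp_subgroup[OF Wn] one_is_normal _ _ x M(2)])
        fix y w assume "y \<in> M" "w \<in> W"
        then have "comm G y w \<in> hyper k"
          using W(3) by (auto simp: centralizer_mod_def)
        then show "comm G y w \<in> cent X"
          using DC[OF X(2)] by blast
      next
        fix w x assume "w \<in> W" "x \<in> X"
        then have "comm G w x \<in> cent (carrier G)" using VX1 W(2) by auto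
        then show "comm G w x \<in> cent M"
          using centralizer_mod_mono[OF normal_subset[OF Mn], of "{\<one>}" "{\<one>}"] by blast
      qed
      then show "comm G x g \<in> cent U"
        using max[OF W(1)] W(2) V(2) by blast
    qed
  qed
qed

theorem MC_group_locally_nilpotent_normal:
  assumes MC: "MC_group G"
    and loc: "\<And>S. finite S \<Longrightarrow> S \<subseteq> carrier G \<Longrightarrow> \<exists>N. nilpotent_normal G N \<and> S \<subseteq> N"
  shows "nilpotent_group G"
proof (rule ccontr)
  assume "\<not> nilpotent_group G"
  then have "non_hyper (carrier G)"
    by (simp add: nilpotent_group_iff non_hyper_def normal_invI subgroup_self)
  then have "Collect non_hyper \<noteq> {}" by blast
  then obtain U where U: "U \<in> Collect non_hyper"
    and max: "\<And>B. B \<in> Collect non_hyper \<Longrightarrow> cent U \<subseteq> cent B \<Longrightarrow> cent B = cent U"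
    by (rule MC_group_maximal[OF MC]) (auto dest: normal_subset simp: non_hyper_def)
  have Un: "non_hyper U" "U \<lhd> G" using U by (auto simp: non_hyper_def)
  \<comment> \<open>\<open>V \<subseteq> U\<close> already gives
    \<open>cent U \<subseteq> cent V\<close>, so maximality forces equality.\<close>
  have sub: "cent V \<subseteq> cent U" if "non_hyper V" "V \<subseteq> U" for V
    using max[of V] that centralizer_mod_mono[of V U "{\<one>}" "{\<one>}"] by blast
  show False
  proof (rule exists_central_modulo_cent[OF MC _ Un(1)])
    fix X V j assume X: "X \<lhd> G" "\<And>x g. x \<in> X \<Longrightarrow> g \<in> carrier G \<Longrightarrow> comm G x g \<in> cent U"
      "\<not> X \<subseteq> cent U" "non_hyper V" "V \<subseteq> U" "X \<subseteq> centralizer_mod G V (hyper j)"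
    have "X \<subseteq> cent U"
      by (rule central_modulo_cent[OF Un(2) _ X(1) _ X(4,5,6)]) (fact sub, fact X(2))
    then show False using X(3) by blast
  qed (fact loc, fact sub)
qed

text \<open>Centralizers in \<open>H\<close> are traces of centralizers in \<open>G\<close>, but the
  latter need not be nested along a chain in \<open>H\<close>. Replacing \<open>A i\<close> by the
  union of all \<open>A k\<close> with \<open>k \<le> i\<close> nests them without changing the
  traces, so strictness carries over to \<open>G\<close>.\<close>

lemma MC_group_subgroup:
  assumes MC: "MC_group G" and H: "subgroup H G"
  shows "MC_group (G\<lparr>carrier := H\<rparr>)"
  unfolding MC_group_def
proof (intro conjI notI)
  show "group (G\<lparr>carrier := H\<rparr>)" using H subgroup_imp_group by blast
  have Hc: "centralizer (G\<lparr>carrier := H\<rparr>) B = centralizer G B \<inter> H" for B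
    using subgroup.subset[OF H] by (auto simp: centralizer_def)
  assume "\<exists>A. (\<forall>i. A i \<subseteq> carrier (G\<lparr>carrier := H\<rparr>)) \<and>
    (\<forall>i::nat. centralizer (G\<lparr>carrier := H\<rparr>) (A (Suc i)) \<subset> centralizer (G\<lparr>carrier := H\<rparr>) (A i))"
  then obtain A :: "nat \<Rightarrow> 'a set" where A: "\<And>i. A i \<subseteq> H"
    and desc: "\<And>i. centralizer G (A (Suc i)) \<inter> H \<subset> centralizer G (A i) \<inter> H"
    by (auto simp: Hc)
  have anti: "centralizer G (A j) \<inter> H \<subseteq> centralizer G (A i) \<inter> H" if "i \<le> j" for i j
    using lift_Suc_antimono_le[of "\<lambda>i. centralizer G (A i) \<inter> H", OF _ that] desc by blast
  let ?B = "\<lambda>i. \<Union>k\<le>i. A k"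
  have BA: "centralizer G (?B i) \<inter> H = centralizer G (A i) \<inter> H" for i
  proof
    show "centralizer G (?B i) \<inter> H \<subseteq> centralizer G (A i) \<inter> H"
      by (auto simp: centralizer_def)
    show "centralizer G (A i) \<inter> H \<subseteq> centralizer G (?B i) \<inter> H"
    proof
      fix x assume x: "x \<in> centralizer G (A i) \<inter> H"
      then have "x \<in> centralizer G (A k)" if "k \<le> i" for k using anti[OF that] by blast
      then show "x \<in> centralizer G (?B i) \<inter> H" using x by (auto simp: centralizer_def)
    qed
  qed
  have "centralizer G (?B (Suc i)) \<subset> centralizer G (?B i)" for i
  proof
    show "centralizer G (?B (Suc i)) \<subseteq> centralizer G (?B i)"
      by (auto simp: centralizer_def)
    show "centralizer G (?B (Suc i)) \<noteq> centralizer G (?B i)"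
      using desc[of i] BA[of i] BA[of "Suc i"] by (metis psubset_eq)
  qed
  moreover have "?B i \<subseteq> carrier G" for i
    using A subgroup.subset[OF H] by blast
  ultimately have "\<exists>B. (\<forall>i. B i \<subseteq> carrier G) \<and>
      (\<forall>i::nat. centralizer G (B (Suc i)) \<subset> centralizer G (B i))"
    by (intro exI[of _ ?B] conjI allI)
  then show False using MC unfolding MC_group_def by (elim conjE notE)
qed

lemma nilpotent_normal_subgroup:
  assumes "subgroup H G" "nilpotent_normal G N" "N \<subseteq> H"
  shows "nilpotent_normal (G\<lparr>carrier := H\<rparr>) N"
proof -
  have N: "N \<lhd> G" using assms by (simp add: nilpotent_normal_def)
  have "N \<lhd> G\<lparr>carrier := H\<rparr>"
    by (rule normal_restrict_supergroup) (use assms N in auto)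
  moreover obtain n where "N \<subseteq> rel_center G N n"
    using assms by (auto simp: nilpotent_normal_def)
  then have "N \<subseteq> rel_center (G\<lparr>carrier := H\<rparr>) N n"
    using assms by (simp add: rel_center_subgroup)
  ultimately show ?thesis unfolding nilpotent_normal_def by blast
qed

theorem MC_group_nilpotent_fitting:
  assumes MC: "MC_group G"
  shows "nilpotent_normal G (fitting G)"
proof -
  let ?F = "fitting G"
  have F: "subgroup ?F G" by (rule normal_imp_subgroup[OF normal_fitting])
  interpret F: group "G\<lparr>carrier := ?F\<rparr>"
    by (rule subgroup_imp_group[OF F])
  have "nilpotent_group (G\<lparr>carrier := ?F\<rparr>)"
  proof (rule F.MC_group_locally_nilpotent_normal[OF MC_group_subgroup[OF MC F]])
    fix S assume "finite S" "S \<subseteq> carrier (G\<lparr>carrier := ?F\<rparr>)"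
    then obtain N where N: "nilpotent_normal G N" "S \<subseteq> N"
      using finite_subset_fitting[of S] by auto
    then have "N \<subseteq> ?F" by (auto simp: fitting_eq_Union)
    then show "\<exists>N. nilpotent_normal (G\<lparr>carrier := ?F\<rparr>) N \<and> S \<subseteq> N"
      using N nilpotent_normal_subgroup[OF F] by blast
  qed
  then show ?thesis
    using normal_fitting by (simp add: nilpotent_normal_iff)
qed

end

section \<open>First-order expressibility\<close>

definition FImp :: "gformula \<Rightarrow> gformula \<Rightarrow> gformula" where
  "FImp \<phi> \<psi> = FNeg (FConj \<phi> (FNeg \<psi>))"

definition FAll :: "nat \<Rightarrow> gformula \<Rightarrow> gformula" where
  "FAll x \<phi> = FNeg (FEx x (FNeg \<phi>))"

definition GComm :: "gterm \<Rightarrow> gterm \<Rightarrow> gterm" where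
  "GComm s t = GMult (GMult (GMult s t) (GInv s)) (GInv t)"

definition GConj :: "gterm \<Rightarrow> gterm \<Rightarrow> gterm" where
  "GConj s t = GMult (GMult s t) (GInv s)"

lemma sat_FImp [simp]: "sat G e (FImp \<phi> \<psi>) \<longleftrightarrow> (sat G e \<phi> \<longrightarrow> sat G e \<psi>)"
  by (simp add: FImp_def)

lemma sat_FAll [simp]: "sat G e (FAll x \<phi>) \<longleftrightarrow> (\<forall>a\<in>carrier G. sat G (e(x := a)) \<phi>)"
  by (simp add: FAll_def)

lemma free_vars_FImp [simp]: "free_vars (FImp \<phi> \<psi>) = free_vars \<phi> \<union> free_vars \<psi>"
  by (simp add: FImp_def)

lemma free_vars_FAll [simp]: "free_vars (FAll x \<phi>) = free_vars \<phi> - {x}"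
  by (simp add: FAll_def)

lemma term_val_GComm [simp]: "term_val G e (GComm s t) = comm G (term_val G e s) (term_val G e t)"
  by (simp add: GComm_def comm_def)

lemma term_val_GConj [simp]:
  "term_val G e (GConj s t) =
    term_val G e s \<otimes>\<^bsub>G\<^esub> term_val G e t \<otimes>\<^bsub>G\<^esub> inv\<^bsub>G\<^esub> (term_val G e s)"
  by (simp add: GConj_def)

lemma term_vars_GComm [simp]: "term_vars (GComm s t) = term_vars s \<union> term_vars t"
  by (auto simp: GComm_def)

lemma term_vars_GConj [simp]: "term_vars (GConj s t) = term_vars s \<union> term_vars t"
  by (auto simp: GConj_def)

lemma term_val_update [simp]: "x \<notin> term_vars t \<Longrightarrow> term_val G (e(x := a)) t = term_val G e t"
  by (induction t) auto

section \<open>Formulas for nilpotent normal closures\<close>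

definition conj_class :: "('a, 'b) monoid_scheme \<Rightarrow> 'a \<Rightarrow> 'a set" where
  "conj_class G x = (\<lambda>g. g \<otimes>\<^bsub>G\<^esub> x \<otimes>\<^bsub>G\<^esub> inv\<^bsub>G\<^esub> g) ` carrier G"

text \<open>The elements whose normal closure is nilpotent of class at most \<open>n\<close>.\<close>

definition nilclosed :: "('a, 'b) monoid_scheme \<Rightarrow> nat \<Rightarrow> 'a set" where
  "nilclosed G n = {x \<in> carrier G. x \<in> rel_center G (conj_class G x) n}"

text \<open>\<open>conj_formula x b n t\<close> says that all commutators of \<open>t\<close> with \<open>n\<close> conjugates of the variable
  \<open>x\<close> are trivial; the bound variables are \<open>b, \<dots>, b + n - 1\<close>, so \<open>t\<close> must not contain them.
  The same convention applies to \<open>center_formula n b m t\<close>, with commutators of \<open>t\<close> with \<open>m\<close>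
  elements of \<open>nilclosed G n\<close>.\<close>

primrec conj_formula :: "nat \<Rightarrow> nat \<Rightarrow> nat \<Rightarrow> gterm \<Rightarrow> gformula" where
  "conj_formula x b 0 t = FEq t GOne"
| "conj_formula x b (Suc n) t =
     FAll (b + n) (conj_formula x b n (GComm t (GConj (GVar (b + n)) (GVar x))))"

text \<open>Starting at \<open>Suc x\<close> keeps the bound variables away from \<open>x\<close>.
  Inside \<open>center_formula\<close> they may repeat outer bound variables, harmlessly, as no
  variable but \<open>x\<close> can be free here.\<close>

definition nilclosed_formula :: "nat \<Rightarrow> nat \<Rightarrow> gformula" where
  "nilclosed_formula n x = conj_formula x (Suc x) n (GVar x)"

primrec center_formula :: "nat \<Rightarrow> nat \<Rightarrow> nat \<Rightarrow> gterm \<Rightarrow> gformula" where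
  "center_formula n b 0 t = FEq t GOne"
| "center_formula n b (Suc m) t =
     FAll (b + m) (FImp (nilclosed_formula n (b + m))
       (center_formula n b m (GComm t (GVar (b + m)))))"

lemma free_vars_conj_formula: "free_vars (conj_formula x b n t) \<subseteq> insert x (term_vars t)"
  by (induction n arbitrary: t) fastforce+

lemma free_vars_nilclosed_formula: "free_vars (nilclosed_formula n x) \<subseteq> {x}"
  unfolding nilclosed_formula_def using free_vars_conj_formula[of x "Suc x" n "GVar x"] by simp

lemma free_vars_center_formula: "free_vars (center_formula n b m t) \<subseteq> term_vars t"
proof (induction m arbitrary: t)
  case (Suc m)
  show ?case
    using Suc[of "GComm t (GVar (b + m))"] free_vars_nilclosed_formula[of n "b + m"] by auto
qed simp

context group
begin

lemma term_val_closed: "range e \<subseteq> carrier G \<Longrightarrow> term_val G e t \<in> carrier G"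
  by (induction t) auto

text \<open>Each quantifier peels one layer off \<open>rel_center\<close>, while the term
  accumulates the iterated commutator; its new variable \<open>b + n\<close> lies just above those
  still to be bound.\<close>

lemma sat_conj_formula:
  assumes "range e \<subseteq> carrier G" "x < b" "term_vars t \<inter> {b..<b + n} = {}"
  shows "sat G e (conj_formula x b n t) \<longleftrightarrow> term_val G e t \<in> rel_center G (conj_class G (e x)) n"
  using assms
proof (induction n arbitrary: e t)
  case (Suc n)
  have bn: "b + n \<notin> term_vars t" "x \<noteq> b + n" using Suc.prems by auto
  have "sat G (e(b + n := a)) (conj_formula x b n (GComm t (GConj (GVar (b + n)) (GVar x)))) \<longleftrightarrow>
      comm G (term_val G e t) (a \<otimes> e x \<otimes> inv a) \<in> rel_center G (conj_class G (e x)) n"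
    if "a \<in> carrier G" for a
  proof (subst Suc.IH)
    show "range (e(b + n := a)) \<subseteq> carrier G" using Suc.prems that by auto
    show "term_vars (GComm t (GConj (GVar (b + n)) (GVar x))) \<inter> {b..<b + n} = {}"
      using Suc.prems by fastforce
  qed (use Suc.prems bn in auto)
  then show ?case
    using term_val_closed[OF Suc.prems(1)]
    by (auto simp: centralizer_mod_def conj_class_def)
qed simp

lemma sat_nilclosed_formula:
  assumes "range e \<subseteq> carrier G"
  shows "sat G e (nilclosed_formula n x) \<longleftrightarrow> e x \<in> nilclosed G n"
  using sat_conj_formula[OF assms, of x "Suc x" "GVar x" n] assms
  by (auto simp: nilclosed_formula_def nilclosed_def)

lemma sat_center_formula:
  assumes "range e \<subseteq> carrier G" "term_vars t \<inter> {b..<b + m} = {}"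
  shows "sat G e (center_formula n b m t) \<longleftrightarrow> term_val G e t \<in> rel_center G (nilclosed G n) m"
  using assms
proof (induction m arbitrary: e t)
  case (Suc m)
  have "sat G (e(b + m := a)) (FImp (nilclosed_formula n (b + m))
        (center_formula n b m (GComm t (GVar (b + m))))) \<longleftrightarrow>
      (a \<in> nilclosed G n \<longrightarrow> comm G (term_val G e t) a \<in> rel_center G (nilclosed G n) m)"
    if a: "a \<in> carrier G" for a
  proof -
    have e: "range (e(b + m := a)) \<subseteq> carrier G" using Suc.prems a by auto
    have "b + m \<notin> term_vars t" using Suc.prems by auto
    moreover have "term_vars (GComm t (GVar (b + m))) \<inter> {b..<b + m} = {}"
      using Suc.prems by fastforce
    ultimately show ?thesis
      by (simp add: sat_nilclosed_formula[OF e] Suc.IH[OF e] del: fun_upd_apply)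
        (simp add: fun_upd_apply)
  qed
  moreover have "nilclosed G n \<subseteq> carrier G" by (auto simp: nilclosed_def)
  ultimately show ?case
    using term_val_closed[OF Suc.prems(1)]
    by (auto simp: centralizer_mod_def subset_iff)
qed simp

lemma models_FAll_iff:
  assumes "\<And>e. range e \<subseteq> carrier G \<Longrightarrow> sat G e \<phi> \<longleftrightarrow> P (e x)"
  shows "models G (FAll x \<phi>) \<longleftrightarrow> (\<forall>a\<in>carrier G. P a)"
proof -
  have "sat G (e(x := a)) \<phi> \<longleftrightarrow> P a" if "range e \<subseteq> carrier G" "a \<in> carrier G" for e a
    using assms[of "e(x := a)"] that by (simp add: image_subset_iff)
  \<comment> \<open>A valuation exists since the carrier contains \<open>\<one>\<close>; so
    \<open>models\<close> is not vacuous.\<close>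
  moreover have "range (\<lambda>_. \<one>) \<subseteq> carrier G" by auto
  ultimately show ?thesis
    unfolding models_def sat_FAll by metis
qed

lemma models_nilclosed_subset:
  "models G (FAll 0 (FImp (nilclosed_formula m 0) (nilclosed_formula n 0))) \<longleftrightarrow>
    nilclosed G m \<subseteq> nilclosed G n"
  by (subst models_FAll_iff[where P = "\<lambda>a. a \<in> nilclosed G m \<longrightarrow> a \<in> nilclosed G n"])
    (auto simp: sat_nilclosed_formula nilclosed_def)

lemma models_nilclosed_center:
  "models G (FAll 0 (FImp (nilclosed_formula n 0) (center_formula n 1 n (GVar 0)))) \<longleftrightarrow>
    nilclosed G n \<subseteq> rel_center G (nilclosed G n) n"
  by (subst models_FAll_iff[where
        P = "\<lambda>a. a \<in> nilclosed G n \<longrightarrow> a \<in> rel_center G (nilclosed G n) n"])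
    (auto simp: sat_nilclosed_formula sat_center_formula nilclosed_def)

section \<open>The Fitting subgroup as a definable set\<close>

lemma conj_closed_conj_class:
  assumes "x \<in> carrier G"
  shows "conj_closed (conj_class G x)"
proof (intro conjI ballI)
  show "conj_class G x \<subseteq> carrier G" using assms by (auto simp: conj_class_def)
  fix g y assume g: "g \<in> carrier G" and "y \<in> conj_class G x"
  then obtain h where h: "h \<in> carrier G" "y = h \<otimes> x \<otimes> inv h" by (auto simp: conj_class_def)
  have "g \<otimes> y \<otimes> inv g = (g \<otimes> h) \<otimes> x \<otimes> inv (g \<otimes> h)"
    using assms g h by (simp add: m_assoc inv_mult_group)
  then show "g \<otimes> y \<otimes> inv g \<in> conj_class G x"
    using g h by (auto simp: conj_class_def)
qed

lemma conj_class_self: "x \<in> carrier G \<Longrightarrow> x \<in> conj_class G x"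
  by (force simp: conj_class_def intro: image_eqI[of _ _ \<one>])

lemma conj_class_subset_normal: "N \<lhd> G \<Longrightarrow> x \<in> N \<Longrightarrow> conj_class G x \<subseteq> N"
  using normal.inv_op_closed2 by (fastforce simp: conj_class_def)

text \<open>The relative center is normal, so with \<open>x\<close> it contains the normal closure
  of \<open>x\<close>, and the series relative to that closure is the same.\<close>

lemma nilclosed_subset_fitting: "nilclosed G n \<subseteq> fitting G"
proof
  fix x assume "x \<in> nilclosed G n"
  then have x: "x \<in> carrier G" "x \<in> rel_center G (conj_class G x) n"
    by (auto simp: nilclosed_def)
  note cc = conj_closed_conj_class[OF x(1)]
  have R: "rel_center G (conj_class G x) n \<lhd> G" by (rule normal_rel_center[OF cc])
  have "generate G (conj_class G x) \<subseteq> rel_center G (conj_class G x) n"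
    by (rule generate_subgroup_incl[OF conj_class_subset_normal[OF R x(2)]
          normal_imp_subgroup[OF R]])
  moreover have "generate G (conj_class G x) \<lhd> G"
    by (rule normal_generateI) (use cc in auto)
  ultimately have "nilpotent_normal G (generate G (conj_class G x))"
    using rel_center_generate[OF cc] unfolding nilpotent_normal_def by blast
  moreover have "x \<in> generate G (conj_class G x)"
    using generate.incl[OF conj_class_self[OF x(1)]] .
  ultimately show "x \<in> fitting G" by (auto simp: fitting_eq_Union)
qed

text \<open>Shrinking the set relative to which the series is formed only enlarges its terms, so the
  class of the Fitting subgroup bounds every class in question.\<close>

lemma nilclosed_of_nilpotent_fitting:
  assumes "fitting G \<subseteq> rel_center G (fitting G) n"
  shows "nilclosed G m \<subseteq> nilclosed G n" "nilclosed G n \<subseteq> rel_center G (nilclosed G n) n"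
proof -
  have sub: "x \<in> rel_center G H n" if "x \<in> fitting G" "H \<subseteq> fitting G" for x H
    using rel_center_antimono[OF that(2)] assms that by blast
  show "nilclosed G m \<subseteq> nilclosed G n"
  proof
    fix x assume x: "x \<in> nilclosed G m"
    then have xF: "x \<in> fitting G" using nilclosed_subset_fitting by blast
    have "x \<in> rel_center G (conj_class G x) n"
      by (rule sub[OF xF conj_class_subset_normal[OF normal_fitting xF]])
    then show "x \<in> nilclosed G n" using x by (simp add: nilclosed_def)
  qed
  show "nilclosed G n \<subseteq> rel_center G (nilclosed G n) n"
    using sub[OF _ nilclosed_subset_fitting] nilclosed_subset_fitting by blast
qed

lemma fitting_eq_nilclosed:
  assumes le: "\<And>m. nilclosed G m \<subseteq> nilclosed G n"
  shows "fitting G = nilclosed G n"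
proof
  show "nilclosed G n \<subseteq> fitting G" by (rule nilclosed_subset_fitting)
  show "fitting G \<subseteq> nilclosed G n"
  proof
    fix x assume "x \<in> fitting G"
    then obtain N m where N: "N \<lhd> G" "N \<subseteq> rel_center G N m" "x \<in> N"
      by (auto simp: fitting_eq_Union nilpotent_normal_def)
    then have "x \<in> rel_center G (conj_class G x) m"
      using rel_center_antimono[OF conj_class_subset_normal[OF N(1,3)], of m] by blast
    then have "x \<in> nilclosed G m"
      using normal_mem_carrier[OF N(1,3)] by (simp add: nilclosed_def)
    then show "x \<in> nilclosed G n" using le by blast
  qed
qed

lemma definable_nilclosed: "definable G (nilclosed G n)"
proof -
  \<comment> \<open>Only variable \<open>0\<close> can be free in the formula, so the set is
    definable without parameters; a constant valuation fills the slot.\<close>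
  let ?e = "\<lambda>_::nat. \<one>"
  have "sat G (?e(0 := a)) (nilclosed_formula n 0) \<longleftrightarrow> a \<in> nilclosed G n" if "a \<in> carrier G" for a
    using that by (subst sat_nilclosed_formula) auto
  then have "nilclosed G n = {a \<in> carrier G. sat G (?e(0 := a)) (nilclosed_formula n 0)}"
    by (auto simp: nilclosed_def)
  moreover have "range ?e \<subseteq> carrier G" by auto
  ultimately show ?thesis unfolding definable_def by blast
qed

end

theorem mainTheorem5:
  fixes G :: "('a, 'm) monoid_scheme" and K :: "('b, 'n) monoid_scheme"
  assumes "MC_group G"
    and "group K"
    and "elementarily_equivalent G K"
  shows "nilpotent_group (K\<lparr>carrier := fitting K\<rparr>) \<and> definable K (fitting K)"
proof -
  interpret G: group G using assms(1) by (simp add: MC_group_def)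
  interpret K: group K by (rule assms(2))
  \<comment> \<open>The class bound found in \<open>G\<close> is the one that transfers to
    \<open>K\<close>.\<close>
  obtain n where n: "fitting G \<subseteq> rel_center G (fitting G) n"
    using G.MC_group_nilpotent_fitting[OF assms(1)] by (auto simp: nilpotent_normal_def)
  have transfer: "models G \<phi> \<longleftrightarrow> models K \<phi>" if "free_vars \<phi> \<subseteq> {}" for \<phi>
    using assms(3) that by (auto simp: elementarily_equivalent_def)
  \<comment> \<open>One sentence is transferred for each \<open>m\<close>; together they identify
    \<open>fitting K\<close> with \<open>nilclosed K n\<close>.\<close>
  have "nilclosed K m \<subseteq> nilclosed K n" for m
    using G.nilclosed_of_nilpotent_fitting(1)[OF n] free_vars_nilclosed_formula[of _ 0]
    unfolding G.models_nilclosed_subset[symmetric] K.models_nilclosed_subset[symmetric]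
    by (subst transfer[symmetric]) auto
  then have F: "fitting K = nilclosed K n"
    by (rule K.fitting_eq_nilclosed)
  have "nilclosed K n \<subseteq> rel_center K (nilclosed K n) n"
    using G.nilclosed_of_nilpotent_fitting(2)[OF n] free_vars_nilclosed_formula[of n 0]
      free_vars_center_formula[of n 1 n "GVar 0"]
    unfolding G.models_nilclosed_center[symmetric] K.models_nilclosed_center[symmetric]
    by (subst transfer[symmetric]) auto
  then have "nilpotent_group (K\<lparr>carrier := fitting K\<rparr>)"
    using K.nilpotent_subgroup_iff[OF normal_imp_subgroup[OF K.normal_fitting]]
    unfolding F by blast
  then show ?thesis
    using K.definable_nilclosed F by simp
qed

end
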